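(* Let $d\ge 1$ and $L\ge 0$ be integers. Consider a uniform or adaptive cubical refinement tree of the unit cube $[0,1]^d$ of maximum refinement level $L$, with its elements (leaves) ordered by the Morton curve. Then any contiguous segment of the Morton curve through this tree (a nonempty set of consecutive leaves in the Morton order) produces at most two distinct face-connected subdomains. This bound holds for every space dimension $d$.
   Context: Cubical refinement: the root is the unit cube $[0,1]^d$ (level $0$). Refining a cube of level $\ell$ splits it into its $2^d$ half-size subcubes (its children, of level $\ell+1$), enumerated by $q=(q_d\ldots q_1)_2\in\{0,\dots,2^d-1\}$, where the bit $q_i\in\{0,1\}$ says whether the subcube lies in the lower ($0$) or higher ($1$) half in coordinate direction $x_i$. A tree is the result of finitely many such refinements starting from the root; its elements (also called quadrants, for any $d$) are its leaves, i.e. the cubes that are not refined further. The tree is uniform of level $L$ if all leaves have level exactly $L$, and adaptive of maximum level $L$ if all leaves have level at most $L$. Morton curve: a cube of level $\ell$ is identified by the sequence $(q^1,\dots,q^\ell)$ of child indices on the path from the root to it. The leaves are totally ordered by lexicographic comparison of these sequences (depth-first traversal of the tree visiting the children in increasing order of $q$). For a uniform level-$L$ tree this is the order of the index $Q=(q^1\ldots q^L)_2\in\{0,\dots,2^{dL}-1\}$. Face-connectedness: two distinct elements are face-adjacent if their intersection is $(d-1)$-dimensional (they meet across a face, or across part of a face when their sizes differ). The face-connected subdomains of a set of elements are the connected components of the graph whose vertices are these elements and whose edges are the face-adjacent pairs. *)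

theory Defs
  imports "HOL-Analysis.Analysis"
begin

text \<open>
  Points of $d$-dimensional space are vectors \<open>v :: real ^ 'n\<close> with \<open>CARD('n) = d\<close>. The Morton
  order depends on how the coordinates are numbered, and a finite type carries no canonical
  numbering, so an explicit one, \<open>idx :: 'n \<Rightarrow> nat\<close>, is a parameter: \<open>v $ j\<close> is the coordinate
  $x_i$ for \<open>i = idx j\<close>, and \<open>idx\<close> is meant to be a bijection onto \<open>{1..d}\<close>.
\<close>

section \<open>Cubes\<close>

text \<open>
  A cube is given by its lowest corner and its side length. In the child index
  $q = (q_d \ldots q_1)_2$ the digit $q_i$ is the binary digit of weight $2^{i-1}$.
\<close>

definition child_offset :: "('n::finite \<Rightarrow> nat) \<Rightarrow> nat \<Rightarrow> real ^ 'n" where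
  "child_offset idx q = (\<chi> j. of_bool (bit q (idx j - 1)))"

fun child :: "('n::finite \<Rightarrow> nat) \<Rightarrow> nat \<Rightarrow> (real ^ 'n) \<times> real \<Rightarrow> (real ^ 'n) \<times> real" where
  "child idx q (a, h) = (a + (h / 2) *\<^sub>R child_offset idx q, h / 2)"

text \<open>
  The address of a cube is the list of child indices on the path from the root to it, the child
  of the root coming first; the length of the address is the level of the cube.
\<close>

type_synonym address = "nat list"

definition cube :: "('n::finite \<Rightarrow> nat) \<Rightarrow> address \<Rightarrow> (real ^ 'n) set" where
  "cube idx p = (case fold (child idx) p (0, 1) of (a, h) \<Rightarrow> cbox a (a + vec h))"

section \<open>Refinement trees\<close>

text \<open>A tree is represented by the set of addresses of its leaves.\<close>

inductive refinement_tree :: "nat \<Rightarrow> address set \<Rightarrow> bool" for d :: nat where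
  root: "refinement_tree d {[]}"
| refine: "refinement_tree d T \<Longrightarrow> p \<in> T \<Longrightarrow>
    refinement_tree d ((T - {p}) \<union> {p @ [q] | q. q < 2 ^ d})"

definition uniform_tree :: "nat \<Rightarrow> nat \<Rightarrow> address set \<Rightarrow> bool" where
  "uniform_tree d L T \<longleftrightarrow> refinement_tree d T \<and> (\<forall>p\<in>T. length p = L)"

definition adaptive_tree :: "nat \<Rightarrow> nat \<Rightarrow> address set \<Rightarrow> bool" where
  "adaptive_tree d L T \<longleftrightarrow> refinement_tree d T \<and> (\<forall>p\<in>T. length p \<le> L)"

section \<open>Morton order\<close>

text \<open>
  \<open>lexord\<close> also puts a proper prefix before its extensions; this never happens between two
  leaves of the same tree.
\<close>

definition morton_less :: "address \<Rightarrow> address \<Rightarrow> bool" where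
  "morton_less p q \<longleftrightarrow> (p, q) \<in> lexord less_than"

definition morton_segment :: "address set \<Rightarrow> address set \<Rightarrow> bool" where
  "morton_segment T S \<longleftrightarrow> S \<noteq> {} \<and> S \<subseteq> T \<and>
    (\<forall>p\<in>S. \<forall>r\<in>S. \<forall>q\<in>T. morton_less p q \<and> morton_less q r \<longrightarrow> q \<in> S)"

section \<open>Face-connected subdomains\<close>

definition face_adjacent :: "('n::finite \<Rightarrow> nat) \<Rightarrow> address \<Rightarrow> address \<Rightarrow> bool" where
  "face_adjacent idx p q \<longleftrightarrow>
    p \<noteq> q \<and> aff_dim (cube idx p \<inter> cube idx q) = int CARD('n) - 1"

text \<open>
  The paths in the reflexive transitive closure below stay inside \<open>S\<close>, so its classes are the
  connected components of the graph induced on \<open>S\<close>.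
\<close>

definition face_connected_in :: "('n::finite \<Rightarrow> nat) \<Rightarrow> address set \<Rightarrow> address rel" where
  "face_connected_in idx S = {(p, q). p \<in> S \<and> q \<in> S \<and> face_adjacent idx p q}\<^sup>*"

definition face_connected_subdomains ::
    "('n::finite \<Rightarrow> nat) \<Rightarrow> address set \<Rightarrow> address set set" where
  "face_connected_subdomains idx S = S // face_connected_in idx S"

end

theory Submission
  imports Defs
begin

text \<open>
  Let \<open>w\<close> be the longest common prefix of the first and the last leaf of the segment, and \<open>a < b\<close>
  the digits that follow it. Choose \<open>k\<close> such that \<open>b div 2 ^ k = a div 2 ^ k + 1\<close>. The children of
  \<open>w\<close> with a fixed value of \<open>c div 2 ^ k\<close> form a box. The segment lies in the boxes of \<open>a\<close> and of
  \<open>b\<close>; it contains with every leaf of the first box all later leaves of that box, and with every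
  leaf of the second box all earlier ones. A leaf of the first box that does not touch the top
  corner of the box has a later face neighbour inside the box: go through an upper face, next to
  the top corner of the leaf. So all leaves of the first part are joined to the leaf at the top
  corner of its box and, by the same argument downwards, those of the second part to the leaf at
  the bottom corner.
\<close>

section \<open>Leaves of a refinement tree\<close>

lemma finite_refinement_tree: "refinement_tree d T \<Longrightarrow> finite T"
  by (induction rule: refinement_tree.induct) auto

lemma refinement_tree_digit_less:
  "refinement_tree d T \<Longrightarrow> p \<in> T \<Longrightarrow> c \<in> set p \<Longrightarrow> c < 2 ^ d"
  by (induction arbitrary: p rule: refinement_tree.induct) auto

lemma refinement_tree_prefix_free:
  "refinement_tree d T \<Longrightarrow> p \<in> T \<Longrightarrow> p @ s \<in> T \<Longrightarrow> s = []"
proof (induction arbitrary: p s rule: refinement_tree.induct)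
  case root
  then show ?case by simp
next
  case (refine T r)
  consider "p \<in> T" "p \<noteq> r" "p @ s \<in> T" | q where "p \<in> T" "p \<noteq> r" "p @ s = r @ [q]"
    | q where "p = r @ [q]" "p @ s \<in> T" | q q' where "p = r @ [q]" "p @ s = r @ [q']"
    using refine.prems by auto
  then show ?case
  proof cases
    case 2
    show ?thesis
    proof (cases s rule: rev_cases)
      case (snoc s' x)
      then have "p @ s' = r" using 2 by simp
      then show ?thesis using refine.IH[of p s'] 2 refine.hyps by auto
    qed
  next
    case 3
    then show ?thesis using refine.IH[of r "q # s"] refine.hyps by simp
  qed (use refine.IH in auto)
qed

text \<open>Leaving the path to a leaf with an arbitrary digit and then repeating one digit must
  end in a leaf, because inner nodes have all their children.\<close>

lemma refinement_tree_branch: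
  assumes "refinement_tree d T" "u @ c # s \<in> T" "c' < 2 ^ d" "e < 2 ^ d"
  shows "\<exists>n. u @ c' # replicate n e \<in> T"
  using assms(1,2)
proof (induction arbitrary: u c s rule: refinement_tree.induct)
  case root
  then show ?case by simp
next
  case (refine T r)
  let ?T' = "(T - {r}) \<union> {r @ [q] | q. q < 2 ^ d}"
  have lift: "\<exists>n. u @ c' # replicate n e \<in> ?T'" if t: "u @ c # t \<in> T" for t
  proof -
    obtain n where n: "u @ c' # replicate n e \<in> T"
      using refine.IH t by blast
    show ?thesis
    \<comment> \<open>If the leaf found before is the very leaf being refined, its child
      \<open>e\<close> continues the repetition.\<close>
    proof (cases "u @ c' # replicate n e = r")
      case True
      then have "u @ c' # replicate (Suc n) e = r @ [e]"
        by (auto simp: replicate_append_same)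
      then show ?thesis using assms(4) by blast
    qed (use n in blast)
  qed
  show ?case
  proof (cases "u @ c # s \<in> T")
    case True
    then show ?thesis by (rule lift)
  next
    case False
    then obtain q where q: "u @ c # s = r @ [q]" using refine.prems by auto
    show ?thesis
    proof (cases s rule: rev_cases)
      case Nil
      then have "u @ c' # replicate 0 e = r @ [c']" using q by simp
      then show ?thesis using assms(3) by blast
    next
      \<comment> \<open>Here the refined leaf \<open>r\<close> already passes through the branching,
        so it serves as the old leaf.\<close>
      case (snoc t x)
      then have "u @ c # t = r" using q by simp
      then show ?thesis using lift refine.hyps by blast
    qed
  qed
qed

section \<open>Face adjacency\<close>

text \<open>Gives the dimension of the common part of two cubes touching across a face: the
  degenerate box lies between a hyperplane and a relatively open piece of it.\<close>

lemma aff_dim_cbox_face: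
  fixes a b :: "real ^ 'n"
  assumes "a $ i = b $ i" and less: "\<And>j. j \<noteq> i \<Longrightarrow> a $ j < b $ j"
  shows "aff_dim (cbox a b) = int CARD('n) - 1"
proof -
  let ?H = "{x :: real ^ 'n. axis i 1 \<bullet> x = a $ i}"
  let ?l = "\<chi> j. if j = i then a $ i - 1 else a $ j"
  let ?u = "\<chi> j. if j = i then a $ i + 1 else b $ j"
  have H: "x \<in> ?H \<longleftrightarrow> x $ i = a $ i" for x
    by (simp add: inner_axis')
  have dimH: "aff_dim ?H = int CARD('n) - 1"
    using aff_dim_hyperplane[of "axis i 1 :: real ^ 'n" "a $ i"] by simp
  \<comment> \<open>The midpoint shows that the hyperplane meets the open box, which is the given
    box widened in direction \<open>i\<close>.\<close>
  have "(\<chi> j. (a $ j + b $ j) / 2) \<in> ?H"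
    unfolding H using assms(1) by simp
  moreover have "(\<chi> j. (a $ j + b $ j) / 2) \<in> box ?l ?u"
    using assms by (auto simp: mem_box_cart)
  ultimately have "aff_dim (?H \<inter> box ?l ?u) = aff_dim ?H"
    by (intro aff_dim_convex_Int_open convex_hyperplane open_box) auto
  moreover have "?H \<inter> box ?l ?u \<subseteq> cbox a b"
  proof
    fix x assume "x \<in> ?H \<inter> box ?l ?u"
    then have xi: "x $ i = a $ i" and xb: "\<And>j. ?l $ j < x $ j \<and> x $ j < ?u $ j"
      unfolding Int_iff H mem_box_cart by blast+
    have "a $ j \<le> x $ j \<and> x $ j \<le> b $ j" for j
      using xi xb[of j] assms(1) by (cases "j = i") auto
    then show "x \<in> cbox a b" by (simp add: mem_box_cart)
  qed
  moreover have "cbox a b \<subseteq> ?H"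
  proof
    fix x assume "x \<in> cbox a b"
    then show "x \<in> ?H" using assms(1) by (metis H mem_box_cart(2) order_antisym)
  qed
  ultimately show ?thesis
    using dimH aff_dim_subset[of "?H \<inter> box ?l ?u" "cbox a b"]
      aff_dim_subset[of "cbox a b" ?H] by linarith
qed

lemma fold_child_side_pos: "h > 0 \<Longrightarrow> snd (fold (child idx) p (a, h)) > 0"
  by (induction p arbitrary: a h) auto

text \<open>The shifts \<open>h/2\<close>, \<open>h/4\<close>, ... form a geometric sum, so
  repeating \<open>e\<close> closes in on the corner selected by its bits.\<close>

lemma fold_child_replicate:
  "fold (child idx) (replicate n e) (a, h)
    = (a + (h * (1 - 1 / 2 ^ n)) *\<^sub>R child_offset idx e, h / 2 ^ n)"
proof (induction n arbitrary: a h)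
  case (Suc n)
  have eq: "h * (1 - 1 / 2 ^ Suc n) = h / 2 + h / 2 * (1 - 1 / 2 ^ n)"
    by (simp add: field_simps)
  show ?case
    unfolding eq scaleR_add_left by (simp add: Suc.IH del: fold_replicate)
qed simp

lemma face_adjacent_sym: "face_adjacent idx p q \<longleftrightarrow> face_adjacent idx q p"
  unfolding face_adjacent_def by (auto simp: Int_commute)

text \<open>Seen from the corner of the child \<open>c\<close> selected by the bits of \<open>e\<close>, the neighbour across
  face \<open>i\<close> has the same corner, now selected by \<open>e\<close> with bit \<open>i\<close> flipped. So the two cubes
  share a corner and lie on the same side of it in all directions but \<open>i\<close>.\<close>

lemma face_adjacent_flip:
  fixes idx :: "'n::finite \<Rightarrow> nat"
  assumes idx: "bij_betw idx UNIV {1..d}" and "i < d" and ne: "bit c i \<noteq> bit e i"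
  shows "face_adjacent idx (u @ c # replicate m e)
    (u @ flip_bit i c # replicate n (flip_bit i e))"
proof -
  \<comment> \<open>Coordinates are numbered from 1 and bits from 0, hence the successor.\<close>
  have "Suc i \<in> idx ` UNIV" using idx \<open>i < d\<close> by (auto simp: bij_betw_def)
  then obtain k where k: "idx k = Suc i" by (metis imageE)
  have other: "idx j - 1 \<noteq> i" if "j \<noteq> k" for j
  proof -
    have "idx j \<in> {1..d}" using idx by (auto simp: bij_betw_def)
    moreover have "idx j \<noteq> idx k" using idx that by (auto simp: bij_betw_def inj_on_def)
    ultimately show ?thesis using k by auto
  qed
  obtain a h where ah: "fold (child idx) u (0, 1) = (a, h)" by fastforce
  define H where "H = h / 2"
  have "H > 0" using fold_child_side_pos[of 1 idx u 0] ah by (simp add: H_def)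
  define low where "low c e m = (\<chi> j. a $ j + H * of_bool (bit c (idx j - 1))
      + H * (1 - 1 / 2 ^ m) * of_bool (bit e (idx j - 1)))" for c e :: nat and m :: nat
  have cube: "cube idx (u @ c # replicate m e) = cbox (low c e m) (low c e m + vec (H / 2 ^ m))"
    for c e m
  proof -
    have "low c e m
      = a + H *\<^sub>R child_offset idx c + (H * (1 - 1 / 2 ^ m)) *\<^sub>R child_offset idx e"
      by (simp add: vec_eq_iff low_def child_offset_def)
    then show ?thesis
      by (simp add: cube_def ah fold_child_replicate del: fold_replicate flip: H_def)
  qed
  let ?c = "flip_bit i c" and ?e = "flip_bit i e"
  have pos: "0 < H / 2 ^ m" for m using \<open>H > 0\<close> by simp
  have bk: "bit (flip_bit i x) (idx k - 1) \<longleftrightarrow> \<not> bit x i" for x :: nat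
    by (simp add: bit_flip_bit_iff k)
  have bo: "bit (flip_bit i x) (idx j - 1) \<longleftrightarrow> bit x (idx j - 1)" if "j \<noteq> k" for x :: nat and j
    using other[OF that] by (auto simp: bit_flip_bit_iff)
  have "cube idx (u @ c # replicate m e) \<inter> cube idx (u @ ?c # replicate n ?e)
    = cbox (\<chi> j. max (low c e m $ j) (low ?c ?e n $ j))
        (\<chi> j. min (low c e m $ j + H / 2 ^ m) (low ?c ?e n $ j + H / 2 ^ n))"
    by (simp add: cube Int_interval_cart interval_cbox_cart)
  also have "aff_dim \<dots> = int CARD('n) - 1"
  \<comment> \<open>In direction \<open>k\<close> the upper end of one cube is the lower end of the
    other. In every other direction both share their lower or both their upper end, so the overlap
    has positive length.\<close>
  proof (rule aff_dim_cbox_face[where i = k])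
    show "(\<chi> j. max (low c e m $ j) (low ?c ?e n $ j)) $ k
      = (\<chi> j. min (low c e m $ j + H / 2 ^ m) (low ?c ?e n $ j + H / 2 ^ n)) $ k"
      using ne \<open>H > 0\<close> pos[of m] pos[of n]
      by (cases "bit c i"; cases "bit e i")
        (simp_all add: low_def k bk[unfolded k, simplified] algebra_simps)
    show "(\<chi> j. max (low c e m $ j) (low ?c ?e n $ j)) $ j
      < (\<chi> j. min (low c e m $ j + H / 2 ^ m) (low ?c ?e n $ j + H / 2 ^ n)) $ j"
      if "j \<noteq> k" for j
      using bo[OF that] \<open>H > 0\<close> pos[of m] pos[of n]
      by (cases "bit e (idx j - 1)") (simp_all add: low_def algebra_simps)
  qed
  finally have "aff_dim (cube idx (u @ c # replicate m e) \<inter> cube idx (u @ ?c # replicate n ?e))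
    = int CARD('n) - 1" .
  moreover have "c \<noteq> ?c" by (metis bit_flip_bit_iff bit_nat_def possible_bit_nat)
  ultimately show ?thesis by (simp add: face_adjacent_def)
qed

section \<open>Morton order\<close>

lemma morton_less_trans: "morton_less p q \<Longrightarrow> morton_less q r \<Longrightarrow> morton_less p r"
  unfolding morton_less_def by (rule lexord_trans) (auto intro: trans_less_than)

lemma morton_less_irrefl: "\<not> morton_less p p"
  unfolding morton_less_def by (simp add: lexord_irreflexive)

lemma morton_less_linear: "morton_less p q \<or> p = q \<or> morton_less q p"
  unfolding morton_less_def by (rule lexord_linear) auto

lemma morton_less_append: "c < c' \<Longrightarrow> morton_less (u @ c # s) (u @ c' # s')"
  unfolding morton_less_def lexord_def by auto

text \<open>Addresses sharing a prefix are consecutive in lexicographic order, which confines a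
  whole segment to the descendants of \<open>w\<close>.\<close>

lemma morton_less_between:
  assumes "morton_less (w @ a # s) q" "morton_less q (w @ b # t)"
  shows "\<exists>c r. q = w @ c # r \<and> a \<le> c \<and> c \<le> b"
  using assms
proof (induction w arbitrary: q)
  case Nil
  then show ?case by (cases q) (auto simp: morton_less_def)
next
  case (Cons x w)
  then obtain q' where "q = x # q'"
    by (cases q) (auto simp: morton_less_def)
  with Cons show ?case by (auto simp: morton_less_def)
qed

text \<open>Prefix-freeness rules out the prefix case of \<open>lexord\<close>, so the two leaves
  differ at a first digit.\<close>

lemma morton_less_split:
  assumes "refinement_tree d T" "p \<in> T" "q \<in> T" "morton_less p q"
  obtains w a s b t where "p = w @ a # s" "q = w @ b # t" "a < b"
proof -
  have "\<not> (\<exists>a v. q = p @ a # v)"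
    using refinement_tree_prefix_free[OF assms(1,2)] assms(3) by blast
  then show ?thesis
    using assms(4) that unfolding morton_less_def lexord_def by auto
qed

section \<open>Moving towards a corner\<close>

lemma flip_bit_less_exp: "x < 2 ^ d \<Longrightarrow> i < d \<Longrightarrow> flip_bit i x < (2 ^ d :: nat)"
  by (metis take_bit_flip_bit_eq linorder_not_le take_bit_nat_eq_self_iff)

lemma less_flip_bit: "\<not> bit x i \<Longrightarrow> x < flip_bit i (x :: nat)"
  by (simp add: flip_bit_eq_if set_bit_eq)

lemma flip_bit_less: "bit x i \<Longrightarrow> flip_bit i (x :: nat) < x"
proof -
  assume "bit x i"
  moreover have "flip_bit i (flip_bit i x) = x"
    by (intro bit_eqI) (auto simp: bit_flip_bit_iff)
  ultimately show ?thesis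
    using less_flip_bit[of "flip_bit i x" i] by (simp add: bit_flip_bit_iff)
qed

text \<open>The Morton order is monotone in each coordinate, so the neighbour comes later exactly
  when it lies across the upper face.\<close>

lemma corner_neighbour:
  fixes idx :: "'n::finite \<Rightarrow> nat" and \<beta> :: bool and d :: nat
  defines "e \<equiv> if \<beta> then mask d else 0"
  assumes T: "refinement_tree d T" and idx: "bij_betw idx UNIV {1..d}"
    and p: "u @ x # replicate m e \<in> T" and i: "i < d" "bit x i \<noteq> \<beta>"
  obtains s where "u @ flip_bit i x # s \<in> T"
    "face_adjacent idx (u @ x # replicate m e) (u @ flip_bit i x # s)"
    "if \<beta> then morton_less (u @ x # replicate m e) (u @ flip_bit i x # s)
     else morton_less (u @ flip_bit i x # s) (u @ x # replicate m e)"
proof -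
  have "x < 2 ^ d" using refinement_tree_digit_less[OF T p] by simp
  moreover have "e < 2 ^ d" by (simp add: e_def mask_eq_exp_minus_1)
  \<comment> \<open>Repeating \<open>flip_bit i e\<close> instead of \<open>e\<close> approaches the
    same corner from the other side of face \<open>i\<close>.\<close>
  ultimately obtain n where n: "u @ flip_bit i x # replicate n (flip_bit i e) \<in> T"
    using refinement_tree_branch[OF T p] flip_bit_less_exp i(1) by blast
  have "bit e i = \<beta>" using i(1) by (simp add: e_def bit_mask_iff)
  then have "face_adjacent idx (u @ x # replicate m e)
      (u @ flip_bit i x # replicate n (flip_bit i e))"
    using face_adjacent_flip[OF idx i(1)] i(2) by blast
  moreover have "if \<beta> then x < flip_bit i x else flip_bit i x < x"
    using i(2) less_flip_bit flip_bit_less by (cases \<beta>) auto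
  ultimately show ?thesis
    using that[OF n] morton_less_append by (cases \<beta>) auto
qed

text \<open>A leaf away from the corner of its box has a wrong bit, either in its tail or among the
  low \<open>k\<close> bits of \<open>c\<close>. Flipping it crosses a face in direction
  \<open>\<beta>\<close> and keeps \<open>drop_bit k c\<close>, hence the box.\<close>

lemma corner_or_neighbour:
  fixes idx :: "'n::finite \<Rightarrow> nat" and \<beta> :: bool and d :: nat
  defines "e \<equiv> if \<beta> then mask d else 0"
  assumes T: "refinement_tree d T" and idx: "bij_betw idx UNIV {1..d}" and "k \<le> d"
    and p: "w @ c # s \<in> T"
  shows "s = replicate (length s) e \<and> (\<forall>i<k. bit c i = \<beta>) \<or>
    (\<exists>c' s'. w @ c' # s' \<in> T \<and> drop_bit k c' = drop_bit k c \<and>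
      face_adjacent idx (w @ c # s) (w @ c' # s') \<and>
      (if \<beta> then morton_less (w @ c # s) (w @ c' # s')
       else morton_less (w @ c' # s') (w @ c # s)))"
proof (cases "\<exists>x\<in>set s. x \<noteq> e")
  case True
  \<comment> \<open>The last wrong digit is taken, so that only copies of \<open>e\<close> follow
    it, as \<open>corner_neighbour\<close> requires.\<close>
  then obtain t x z where s: "s = t @ x # z" "x \<noteq> e" "\<forall>y\<in>set z. y = e"
    using split_list_last_prop[of s "\<lambda>x. x \<noteq> e"] by blast
  then have z: "z = replicate (length z) e" by (simp add: replicate_eqI)
  have "x < 2 ^ d" using refinement_tree_digit_less[OF T p] s(1) by simp
  then have "take_bit d x = x" by (simp add: take_bit_nat_eq_self)
  moreover have "take_bit d e = e" by (simp add: e_def)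
  ultimately obtain i where i: "i < d" "bit x i \<noteq> bit e i"
    using s(2) by (metis bit_eqI bit_take_bit_iff)
  then have "bit x i \<noteq> \<beta>" by (simp add: e_def bit_mask_iff)
  moreover have "(w @ c # t) @ x # replicate (length z) e \<in> T" using p s(1) z by simp
  ultimately obtain s' where "(w @ c # t) @ flip_bit i x # s' \<in> T"
    "face_adjacent idx (w @ c # s) ((w @ c # t) @ flip_bit i x # s')"
    "if \<beta> then morton_less (w @ c # s) ((w @ c # t) @ flip_bit i x # s')
     else morton_less ((w @ c # t) @ flip_bit i x # s') (w @ c # s)"
    using corner_neighbour[OF T idx, of "w @ c # t" x "length z" \<beta> i] i(1) s(1) z
    unfolding e_def by (metis append_Cons append_assoc)
  then show ?thesis by (auto intro!: exI[of _ c] exI[of _ "t @ flip_bit i x # s'"])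
next
  case False
  then have s: "s = replicate (length s) e" by (simp add: replicate_eqI)
  show ?thesis
  proof (cases "\<forall>i<k. bit c i = \<beta>")
    case True
    then show ?thesis using s by blast
  next
    case False
    then obtain i where i: "i < k" "bit c i \<noteq> \<beta>" by blast
    then obtain s' where "w @ flip_bit i c # s' \<in> T"
      "face_adjacent idx (w @ c # s) (w @ flip_bit i c # s')"
      "if \<beta> then morton_less (w @ c # s) (w @ flip_bit i c # s')
       else morton_less (w @ flip_bit i c # s') (w @ c # s)"
      using corner_neighbour[OF T idx, of w c "length s" \<beta> i] p s \<open>k \<le> d\<close>
      unfolding e_def by (metis order_less_le_trans)
    moreover have "drop_bit k (flip_bit i c) = drop_bit k c"
      using i(1) by (intro bit_eqI) (auto simp: bit_drop_bit_eq bit_flip_bit_iff)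
    ultimately show ?thesis by blast
  qed
qed

text \<open>High and low bits together determine the digit; then one address is a prefix of the
  other, and prefix-freeness makes them equal.\<close>

lemma corner_unique:
  assumes T: "refinement_tree d T"
    and "w @ c # replicate m e \<in> T" "w @ c' # replicate n e \<in> T"
    and "drop_bit k c = drop_bit k c'" and low: "\<And>i. i < k \<Longrightarrow> bit c i = bit c' i"
  shows "w @ c # replicate m e = w @ c' # replicate n e"
proof -
  have "take_bit k c = take_bit k c'"
    using low by (intro bit_eqI) (auto simp: bit_take_bit_iff)
  then have "c = c'" using assms(4) by (metis bits_ident)
  moreover have "m = n" if "m \<le> n" "w @ c # replicate m e \<in> T" "w @ c # replicate n e \<in> T" for m n
  proof -
    have "w @ c # replicate n e = (w @ c # replicate m e) @ replicate (n - m) e"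
      using that(1) by (simp flip: replicate_add)
    then have "replicate (n - m) e = []"
      using refinement_tree_prefix_free[OF T that(2)] that(3) by metis
    then show ?thesis using that(1) by simp
  qed
  ultimately show ?thesis using assms(2,3) by (metis nle_le)
qed

text \<open>Each step strictly shrinks the finite set of \<open>R\<close>-successors: by
  transitivity none is gained, and by irreflexivity \<open>q\<close> itself is lost.\<close>

lemma reaches_terminal:
  assumes "finite A" "transp R" "irreflp R"
    and step: "\<And>p. p \<in> A \<Longrightarrow> P p \<or> (\<exists>q\<in>A. R p q \<and> (p, q) \<in> E)"
    and "p \<in> A"
  shows "\<exists>z\<in>A. P z \<and> (p, z) \<in> E\<^sup>*"
  using \<open>p \<in> A\<close>
proof (induction "card {q \<in> A. R p q}" arbitrary: p rule: less_induct)
  case less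
  show ?case
  proof (cases "P p")
    case False
    then obtain q where q: "q \<in> A" "R p q" "(p, q) \<in> E" using step less.prems by blast
    have "{r \<in> A. R q r} \<subset> {r \<in> A. R p r}"
      using q assms(2,3) by (auto dest: transpD irreflpD)
    then have "card {r \<in> A. R q r} < card {r \<in> A. R p r}"
      using assms(1) by (intro psubset_card_mono) auto
    then obtain z where "z \<in> A" "P z" "(q, z) \<in> E\<^sup>*" using less.hyps q(1) by blast
    then show ?thesis using q(3) by (meson converse_rtrancl_into_rtrancl)
  qed (use less.prems in blast)
qed

text \<open>The number \<open>k\<close> is the position of the highest bit in which \<open>a\<close>
  and \<open>b\<close> differ.\<close>

lemma adjacent_drop_bit:
  fixes a b :: nat
  assumes "a < b"
  obtains k where "drop_bit k b = Suc (drop_bit k a)"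
proof -
  let ?P = "\<lambda>k. drop_bit k a < drop_bit k b"
  have bound: "k \<le> b" if "?P k" for k
  proof (rule ccontr)
    assume "\<not> k \<le> b"
    then have "b < 2 ^ k" by (meson less_exp less_trans not_le)
    then show False using that by (simp add: drop_bit_eq_div)
  qed
  define k where "k = (GREATEST k. ?P k)"
  have "?P 0" using assms by simp
  then have k: "?P k" unfolding k_def using GreatestI_nat bound by (metis (lifting))
  have "\<not> ?P (Suc k)"
  proof
    assume "?P (Suc k)"
    then have "Suc k \<le> k" unfolding k_def using Greatest_le_nat bound by (metis (lifting))
    then show False by simp
  qed
  \<comment> \<open>Two numbers in strict order whose halves are no longer so can differ only by
    one.\<close>
  then have "\<not> drop_bit k a div 2 < drop_bit k b div 2"
    by (simp add: drop_bit_eq_div power_Suc2 div_mult2_eq del: power_Suc)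
  then have "drop_bit k b = Suc (drop_bit k a)" using k by linarith
  then show ?thesis by (rule that)
qed

section \<open>The two parts of a segment\<close>

lemma face_connected_in_equiv:
  "sym (face_connected_in idx S)" "trans (face_connected_in idx S)"
proof -
  show "sym (face_connected_in idx S)"
    unfolding face_connected_in_def
    by (intro sym_rtrancl symI) (auto simp: face_adjacent_sym)
  show "trans (face_connected_in idx S)"
    unfolding face_connected_in_def by (rule trans_rtrancl)
qed

lemma card_quotient_le_1:
  assumes "sym r" "trans r" and conn: "\<And>x y. x \<in> A \<Longrightarrow> y \<in> A \<Longrightarrow> (x, y) \<in> r"
  shows "finite (A // r) \<and> card (A // r) \<le> 1"
proof (cases "A = {}")
  case False
  then obtain x where x: "x \<in> A" by blast
  have "r `` {y} = r `` {x}" if "y \<in> A" for y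
    using conn[OF x that] assms(1,2) by (auto dest: symD transD)
  then have "A // r \<subseteq> {r `` {x}}" by (auto simp: quotient_def)
  then show ?thesis
    using card_mono[of "{r `` {x}}" "A // r"] by (auto intro: finite_subset)
qed simp

text \<open>The set \<open>P\<close> is the part of the segment that extends to the end of a block of siblings in
  the direction \<open>\<beta>\<close> (\<open>True\<close> is upwards).\<close>

lemma segment_part_connected:
  fixes idx :: "'n::finite \<Rightarrow> nat" and \<beta> :: bool
  assumes T: "refinement_tree d T" and idx: "bij_betw idx UNIV {1..d}" and "k \<le> d"
    and S: "S \<subseteq> T"
    and P: "P = {p \<in> S. \<exists>c s. p = w @ c # s \<and> drop_bit k c = v}"
    and closed: "\<And>p c s. p \<in> P \<Longrightarrow> w @ c # s \<in> T \<Longrightarrow> drop_bit k c = v \<Longrightarrow>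
      (if \<beta> then morton_less p (w @ c # s) else morton_less (w @ c # s) p) \<Longrightarrow> w @ c # s \<in> S"
    and pq: "p \<in> P" "q \<in> P"
  shows "(p, q) \<in> face_connected_in idx S"
proof -
  define e :: nat where "e = (if \<beta> then mask d else 0)"
  let ?R = "\<lambda>p q. if \<beta> then morton_less p q else morton_less q p"
  let ?E = "{(p, q). p \<in> S \<and> q \<in> S \<and> face_adjacent idx p q}"
  \<comment> \<open>This describes the leaf at the top (for \<open>\<beta>\<close> true) or bottom
    corner of the block, where the walks stop.\<close>
  let ?Q = "\<lambda>p. \<exists>c m. p = w @ c # replicate m e \<and> drop_bit k c = v \<and> (\<forall>i<k. bit c i = \<beta>)"
  have "finite P" using finite_refinement_tree[OF T] S P by (auto intro: finite_subset)
  moreover have "transp ?R" using morton_less_trans by (auto intro!: transpI)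
  moreover have "irreflp ?R" using morton_less_irrefl by (auto intro!: irreflpI)
  moreover have "?Q p \<or> (\<exists>q\<in>P. ?R p q \<and> (p, q) \<in> ?E)" if pP: "p \<in> P" for p
  proof -
    obtain c s where p: "p = w @ c # s" "drop_bit k c = v" "p \<in> S" using pP unfolding P by blast
    then have "w @ c # s \<in> T" using S by blast
    from corner_or_neighbour[OF T idx \<open>k \<le> d\<close> this, of \<beta>, folded e_def] show ?thesis
    proof (elim disjE exE conjE)
      fix c' s' assume q: "w @ c' # s' \<in> T" "drop_bit k c' = drop_bit k c"
        "face_adjacent idx (w @ c # s) (w @ c' # s')" "?R (w @ c # s) (w @ c' # s')"
      then have "w @ c' # s' \<in> S" using closed[OF pP q(1)] p by simp
      moreover from this have "w @ c' # s' \<in> P" using P q(2) p(2) by auto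
      ultimately show ?thesis using q p by blast
    qed (use p in metis)
  qed
  ultimately have reach: "\<exists>z\<in>P. ?Q z \<and> (p, z) \<in> face_connected_in idx S" if "p \<in> P" for p
    unfolding face_connected_in_def using that by (rule reaches_terminal)
  obtain y where y: "y \<in> P" "?Q y" "(p, y) \<in> face_connected_in idx S" using reach pq(1) by blast
  obtain z where z: "z \<in> P" "?Q z" "(q, z) \<in> face_connected_in idx S" using reach pq(2) by blast
  have "y \<in> T" "z \<in> T" using y(1) z(1) P S by auto
  obtain c m where c: "y = w @ c # replicate m e" "drop_bit k c = v" "\<forall>i<k. bit c i = \<beta>"
    using y(2) by blast
  obtain c' n where c': "z = w @ c' # replicate n e" "drop_bit k c' = v" "\<forall>i<k. bit c' i = \<beta>"
    using z(2) by blast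
  \<comment> \<open>The walks from \<open>p\<close> and \<open>q\<close> end at the same corner
    leaf, which joins them.\<close>
  have "y = z"
    using corner_unique[OF T, of w c m e c' n k] \<open>y \<in> T\<close> \<open>z \<in> T\<close> c c' by simp
  then show ?thesis
    using y(3) z(3) face_connected_in_equiv by (metis symD transD)
qed

theorem theorem1:
  fixes d L :: nat
    and idx :: "'n::finite \<Rightarrow> nat"
    and T S :: "address set"
  assumes "d \<ge> 1"
    and "CARD('n) = d"
    and "bij_betw idx UNIV {1..d}"
    and "uniform_tree d L T \<or> adaptive_tree d L T"
    and "morton_segment T S"
  shows "finite (face_connected_subdomains idx S)
    \<and> card (face_connected_subdomains idx S) \<le> 2"
proof -
  let ?F = "face_connected_in idx S"
  have T: "refinement_tree d T"
    using assms(4) by (auto simp: uniform_tree_def adaptive_tree_def)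
  have S: "S \<noteq> {}" "S \<subseteq> T" and convex:
    "\<And>p q r. p \<in> S \<Longrightarrow> r \<in> S \<Longrightarrow> q \<in> T \<Longrightarrow> morton_less p q \<Longrightarrow> morton_less q r \<Longrightarrow> q \<in> S"
    using assms(5) unfolding morton_segment_def by blast+
  have "finite S" using finite_refinement_tree[OF T] S(2) finite_subset by blast
  moreover have "asymp_on S morton_less"
    using morton_less_trans morton_less_irrefl by (auto intro!: asymp_onI)
  moreover have "transp_on S morton_less"
    using morton_less_trans by (auto intro!: transp_onI)
  moreover have "totalp_on S morton_less"
    using morton_less_linear by (auto intro!: totalp_onI)
  ultimately obtain lo hi where lo: "lo \<in> S" "\<And>p. p \<in> S \<Longrightarrow> p \<noteq> lo \<Longrightarrow> morton_less lo p"
    and hi: "hi \<in> S" "\<And>p. p \<in> S \<Longrightarrow> p \<noteq> hi \<Longrightarrow> morton_less p hi"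
    using Finite_Set.bex_least_element[of S morton_less]
      Finite_Set.bex_greatest_element[of S morton_less] S(1) by auto
  show ?thesis
  proof (cases "lo = hi")
    case True
    have "S = {lo}"
      using lo hi True morton_less_trans morton_less_irrefl by blast
    then show ?thesis
      by (simp add: face_connected_subdomains_def quotient_def)
  next
    case False
    then have "morton_less lo hi" using lo hi by blast
    then obtain w a s b t where w: "lo = w @ a # s" "hi = w @ b # t" and "a < b"
      using morton_less_split[OF T] lo(1) hi(1) S(2) by blast
    obtain k where k: "drop_bit k b = Suc (drop_bit k a)"
      using adjacent_drop_bit[OF \<open>a < b\<close>] .
    have "b < 2 ^ d" using refinement_tree_digit_less[OF T, of hi b] w hi(1) S(2) by auto
    \<comment> \<open>Otherwise all bits of \<open>b\<close> would be dropped, although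
      \<open>drop_bit k b\<close> is a successor.\<close>
    have "k \<le> d"
    proof (rule ccontr)
      assume "\<not> k \<le> d"
      then have "b < 2 ^ k" using \<open>b < 2 ^ d\<close>
        by (meson less_trans not_le one_less_numeral_iff power_strict_increasing semiring_norm(76))
      then show False using k by (simp add: drop_bit_eq_div)
    qed
    define part where "part v = {p \<in> S. \<exists>c s. p = w @ c # s \<and> drop_bit k c = v}" for v
    have mono: "x \<le> y \<Longrightarrow> drop_bit k x \<le> drop_bit k y" for x y :: nat
      by (simp add: drop_bit_eq_div div_le_mono)
    have "S \<subseteq> part (drop_bit k a) \<union> part (drop_bit k b)"
    proof
      fix p assume "p \<in> S"
      have "\<exists>c r. p = w @ c # r \<and> a \<le> c \<and> c \<le> b"
      proof (cases "p = lo \<or> p = hi")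
        case True
        then show ?thesis using w \<open>a < b\<close> by auto
      next
        case False
        then show ?thesis
          using morton_less_between lo(2) hi(2) \<open>p \<in> S\<close> w by metis
      qed
      then obtain c r where c: "p = w @ c # r" "a \<le> c" "c \<le> b" by blast
      then have "drop_bit k c = drop_bit k a \<or> drop_bit k c = drop_bit k b"
        using mono[of a c] mono[of c b] k by auto
      then show "p \<in> part (drop_bit k a) \<union> part (drop_bit k b)"
        using c(1) \<open>p \<in> S\<close> by (auto simp: part_def)
    qed
    then have "S = part (drop_bit k a) \<union> part (drop_bit k b)" by (auto simp: part_def)
    \<comment> \<open>Both quotients use connectedness in all of \<open>S\<close>, so their classes
      are whole subdomains of \<open>S\<close>.\<close>
    then have quot: "S // ?F = part (drop_bit k a) // ?F \<union> part (drop_bit k b) // ?F"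
      by (metis quotient_def UN_Un)
    have "(p, q) \<in> ?F" if pq: "p \<in> part (drop_bit k a)" "q \<in> part (drop_bit k a)" for p q
    proof (rule segment_part_connected[OF T assms(3) \<open>k \<le> d\<close> S(2) part_def, where \<beta> = True])
      fix p c r assume "p \<in> part (drop_bit k a)" and q: "w @ c # r \<in> T" "drop_bit k c = drop_bit k a"
        and less: "if True then morton_less p (w @ c # r) else morton_less (w @ c # r) p"
      then have "p \<in> S" by (simp add: part_def)
      \<comment> \<open>The block of \<open>a\<close> precedes that of \<open>b\<close>, so the leaf
        lies between \<open>p\<close> and \<open>hi\<close> and convexity applies.\<close>
      moreover have "c < b" using q(2) k mono[of b c] by (cases "c < b") auto
      then have "morton_less (w @ c # r) hi" using w(2) morton_less_append by simp
      ultimately show "w @ c # r \<in> S" using convex[OF _ hi(1) q(1)] less by simp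
    qed (use pq in auto)
    then have a: "finite (part (drop_bit k a) // ?F) \<and> card (part (drop_bit k a) // ?F) \<le> 1"
      by (intro card_quotient_le_1 face_connected_in_equiv)
    have "(p, q) \<in> ?F" if pq: "p \<in> part (drop_bit k b)" "q \<in> part (drop_bit k b)" for p q
    proof (rule segment_part_connected[OF T assms(3) \<open>k \<le> d\<close> S(2) part_def, where \<beta> = False])
      fix p c r assume "p \<in> part (drop_bit k b)" and q: "w @ c # r \<in> T" "drop_bit k c = drop_bit k b"
        and less: "if False then morton_less p (w @ c # r) else morton_less (w @ c # r) p"
      then have "p \<in> S" by (simp add: part_def)
      \<comment> \<open>Dually, the leaf lies between \<open>lo\<close> and
        \<open>p\<close>.\<close>
      moreover have "a < c" using q(2) k mono[of c a] by (cases "a < c") auto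
      then have "morton_less lo (w @ c # r)" using w(1) morton_less_append by simp
      ultimately show "w @ c # r \<in> S" using convex[OF lo(1) _ q(1)] less by simp
    qed (use pq in auto)
    then have b: "finite (part (drop_bit k b) // ?F) \<and> card (part (drop_bit k b) // ?F) \<le> 1"
      by (intro card_quotient_le_1 face_connected_in_equiv)
    show ?thesis
      unfolding face_connected_subdomains_def quot
      using a b card_Un_le[of "part (drop_bit k a) // ?F" "part (drop_bit k b) // ?F"] by auto
  qed
qed

end
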